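(* Let $\mathcal F_{Q,h}^\star$, $h=1,\ldots,N_{\mathrm f}$, be the selected one-step scalar NLARX time-advance operators defined in the context. Consider two forecasts generated by the same selected NLARX model from initial quantity-history states $\bm s_0^{(1)},\bm s_0^{(2)}\in\mathbb R^{n_a}$ and delayed driver sequences $\{\bm w_h^{(1)}\}_{h=1}^{N_{\mathrm f}}$, $\{\bm w_h^{(2)}\}_{h=1}^{N_{\mathrm f}}\subset\mathbb R^{mn_b}$, and for $i=1,2$ define $$\mathcal C_{Q,h}^{(i)}=\mathcal F_{Q,h}^\star(\,\cdot\,;\bm w_h^{(i)})\circ\cdots\circ\mathcal F_{Q,1}^\star(\,\cdot\,;\bm w_1^{(i)}),\qquad h=1,\ldots,N_{\mathrm f}.$$ Assume that the quantity-history states and driver blocks visited by the two forecasts belong to a compact set. Since the selected feature map $\bm\varphi_Q$ is continuously differentiable, there exist finite constants $L_s^Q,L_w^Q\ge0$ such that $$\bigl\|\mathcal F_{Q,h}^\star(\bm s_1;\bm w_1)-\mathcal F_{Q,h}^\star(\bm s_2;\bm w_2)\bigr\|_2\le L_s^Q\|\bm s_1-\bm s_2\|_2+L_w^Q\|\bm w_1-\bm w_2\|_2$$ for every visited state–driver pair $(\bm s_1,\bm w_1)$, $(\bm s_2,\bm w_2)$ and every $h=1,\ldots,N_{\mathrm f}$. Then the two composed forecast states satisfy, for $h=1,\ldots,N_{\mathrm f}$, $$\bigl\|\mathcal C_{Q,h}^{(1)}(\bm s_0^{(1)})-\mathcal C_{Q,h}^{(2)}(\bm s_0^{(2)})\bigr\|_2\le(L_s^Q)^h\|\bm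 s_0^{(1)}-\bm s_0^{(2)}\|_2+L_w^Q\sum_{j=1}^h(L_s^Q)^{h-j}\|\bm w_j^{(1)}-\bm w_j^{(2)}\|_2 .$$ Consequently, the forecasts in physical units satisfy $$\bigl|\widehat q_{N_Q+h}^{(1)}-\widehat q_{N_Q+h}^{(2)}\bigr|\le\sigma_Q\Bigl[(L_s^Q)^h\|\bm s_0^{(1)}-\bm s_0^{(2)}\|_2+L_w^Q\sum_{j=1}^h(L_s^Q)^{h-j}\|\bm w_j^{(1)}-\bm w_j^{(2)}\|_2\Bigr].$$ Thus, the composed numerical forecast is uniquely defined and Lipschitz stable on every prescribed finite forecast horizon.
   Context: All quantities are real. $m\ge1$ is the number of channels; $(n_a,n_b,n_k)$ (in the paper $(n_a^{Q,\star},n_b^{Q,\star},n_k^{Q,\star})$) is the selected order triple with $n_a,n_b\ge1$, $n_k\ge0$; $d=n_a+mn_b$; $N_{\mathrm f}\ge1$ is the number of forecast steps; $N_Q\ge1$ is the index of the last observed sample. The feature map $\bm\varphi_Q:\mathbb R^d\to\mathbb R^{4d+2}$ is $$\bm\varphi_Q(\bm z)=\bigl[1,\ \bm z^{\mathsf T},\ \tanh(\bm z)^{\mathsf T},\ (\bm z^{\odot2})^{\mathsf T},\ (\bm z^{\odot3})^{\mathsf T},\ \|\bm z\|_2^2\bigr]^{\mathsf T},$$ with $\tanh$ and the powers $\odot2,\odot3$ applied componentwise, and $\bm\theta_Q^\star\in\mathbb R^{4d+2}$ is the fixed selected parameter vector. For $\bm s\in\mathbb R^{n_a}$ (vector of past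 normalized outputs, most recent first) and $\bm w\in\mathbb R^{mn_b}$ (block of delayed normalized channel drivers) the one-step time-advance operator is $$\mathcal F_{Q,h}^\star(\bm s;\bm w)=\begin{bmatrix}(\bm\theta_Q^\star)^{\mathsf T}\bm\varphi_Q\bigl([\bm s^{\mathsf T},\bm w^{\mathsf T}]^{\mathsf T}\bigr)\\ s_1\\ \vdots\\ s_{n_a-1}\end{bmatrix}\in\mathbb R^{n_a},\qquad h=1,\ldots,N_{\mathrm f},$$ the shift block being empty when $n_a=1$. The states visited by forecast $i$ are $\bm s_0^{(i)}$ and $\bm s_h^{(i)}=\mathcal C_{Q,h}^{(i)}(\bm s_0^{(i)})$, with driver blocks $\bm w_h^{(i)}$. The forecast in physical units is $\widehat q_{N_Q+h}^{(i)}=\mu_Q+\sigma_Q(\bm s_h^{(i)})_1$, where $\mu_Q\in\mathbb R$ and $\sigma_Q>0$ are fixed normalization constants. Convention: $(L_s^Q)^0=1$. *)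

theory Defs
  imports "HOL-Analysis.Analysis"
begin

definition vconcat :: "real ^ 'a \<Rightarrow> real ^ 'b \<Rightarrow> real ^ ('a + 'b)" (infixr "@\<^sub>v" 65)
  where "x @\<^sub>v y = (\<chi> i. case i of Inl a \<Rightarrow> x $ a | Inr b \<Rightarrow> y $ b)"

text \<open>For an index type of cardinality \<open>d\<close> this one has cardinality \<open>4 * d + 2\<close>.\<close>

type_synonym 'd feature = "unit + 'd + 'd + 'd + 'd + unit"

definition feature_map :: "real ^ 'd \<Rightarrow> real ^ ('d feature)"
  where "feature_map z =
    (\<chi> _. 1) @\<^sub>v z @\<^sub>v (\<chi> i. tanh (z $ i)) @\<^sub>v (\<chi> i. (z $ i)\<^sup>2) @\<^sub>v (\<chi> i. (z $ i) ^ 3)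
      @\<^sub>v (\<chi> _. (norm z)\<^sup>2)"

text \<open>
  The history \<open>(s\<^sub>1, \<dots>, s\<^sub>n)\<close>, most recent value first, is indexed by a finite linearly ordered
  type with \<open>n\<close> elements: \<open>Min UNIV\<close> is position 1 and \<open>Max {..<i}\<close> is the position preceding
  \<open>i\<close>. The operator is given by the same formula at every forecast step, so it carries no step
  index; the step enters through the driver block only.
\<close>

definition nlarx_step ::
  "real ^ (('a + 'w) feature) \<Rightarrow> real ^ ('a::{finite,linorder}) \<Rightarrow> real ^ 'w \<Rightarrow> real ^ ('a::{finite,linorder})"
  where "nlarx_step \<theta> s w =
    (\<chi> i. if i = Min UNIV then \<theta> \<bullet> feature_map (s @\<^sub>v w) else s $ Max {..<i})"

text \<open>The driver block used in step \<open>h\<close> is \<open>w h\<close> with \<open>h \<ge> 1\<close>; the value \<open>w 0\<close> is never used.\<close>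

primrec composed ::
  "real ^ (('a + 'w) feature) \<Rightarrow> (nat \<Rightarrow> real ^ 'w) \<Rightarrow> nat
    \<Rightarrow> real ^ ('a::{finite,linorder}) \<Rightarrow> real ^ ('a::{finite,linorder})"
  where
    "composed \<theta> w 0 = id"
  | "composed \<theta> w (Suc h) = (\<lambda>s. nlarx_step \<theta> s (w (Suc h))) \<circ> composed \<theta> w h"

definition visited_pairs ::
  "real ^ (('a + 'w) feature) \<Rightarrow> nat \<Rightarrow> real ^ ('a::{finite,linorder}) \<Rightarrow> (nat \<Rightarrow> real ^ 'w)
    \<Rightarrow> ((real ^ ('a::{finite,linorder})) \<times> (real ^ 'w)) set"
  where "visited_pairs \<theta> N s0 w = {(composed \<theta> w h s0, w (Suc h)) | h. h < N}"

definition step_lipschitz_on ::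
  "real ^ (('a + 'w) feature) \<Rightarrow> ((real ^ ('a::{finite,linorder})) \<times> (real ^ 'w)) set
    \<Rightarrow> real \<Rightarrow> real \<Rightarrow> bool"
  where "step_lipschitz_on \<theta> P Ls Lw \<longleftrightarrow>
    (\<forall>(s1, w1) \<in> P. \<forall>(s2, w2) \<in> P.
      norm (nlarx_step \<theta> s1 w1 - nlarx_step \<theta> s2 w2)
        \<le> Ls * norm (s1 - s2) + Lw * norm (w1 - w2))"

text \<open>The argument \<open>t\<close> is the absolute time index; forecast step \<open>h\<close> is \<open>t = NQ + h\<close>.\<close>

definition forecast ::
  "real \<Rightarrow> real \<Rightarrow> nat \<Rightarrow> real ^ (('a + 'w) feature) \<Rightarrow> real ^ ('a::{finite,linorder})
    \<Rightarrow> (nat \<Rightarrow> real ^ 'w) \<Rightarrow> nat \<Rightarrow> real"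
  where "forecast \<mu> \<sigma> NQ \<theta> s0 w t = \<mu> + \<sigma> * (composed \<theta> w (t - NQ) s0 $ Min UNIV)"

text \<open>
  The forecast as a solution of the recursion, without reference to the composed operator.
  Forecast values exist only at the times \<open>NQ + 1, \<dots>, NQ + N\<close>, hence \<^const>\<open>extensional\<close>.
\<close>

definition is_forecast ::
  "real \<Rightarrow> real \<Rightarrow> nat \<Rightarrow> nat \<Rightarrow> real ^ (('a + 'w) feature) \<Rightarrow> real ^ ('a::{finite,linorder})
    \<Rightarrow> (nat \<Rightarrow> real ^ 'w) \<Rightarrow> (nat \<Rightarrow> real) \<Rightarrow> bool"
  where "is_forecast \<mu> \<sigma> NQ N \<theta> s0 w q \<longleftrightarrow>
    q \<in> extensional {NQ + 1..NQ + N} \<and>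
    (\<exists>s. s 0 = s0 \<and> (\<forall>h<N. s (Suc h) = nlarx_step \<theta> (s h) (w (Suc h))) \<and>
         (\<forall>h\<in>{1..N}. q (NQ + h) = \<mu> + \<sigma> * (s h $ Min UNIV)))"

end

theory Submission
  imports Defs
begin

text \<open>
  The feature map is continuously differentiable, hence Lipschitz on a closed ball containing the
  compact set \<open>K\<close>, by the mean value inequality; the ball is needed because \<open>K\<close> itself need not be
  convex. The shift components of the operator are 1-Lipschitz in the state, so the operator is
  Lipschitz on \<open>K\<close>. Unrolling the one-step estimate along the two forecasts gives the geometric
  sums, and the first coordinate, scaled by \<open>\<sigma>\<close>, carries the estimate over to physical units.
\<close>

section \<open>Coordinatewise calculus on concatenated vectors\<close>

lemma vconcat_Inl [simp]: "(x @\<^sub>v y) $ Inl i = x $ i"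
  and vconcat_Inr [simp]: "(x @\<^sub>v y) $ Inr j = y $ j"
  by (simp_all add: vconcat_def)

text \<open>The basis vectors of \<open>real ^ 'n\<close> are the axes, so inner products with them
  are plain coordinates.\<close>

lemma has_derivative_vec_componentwise:
  fixes f :: "'x::real_normed_vector \<Rightarrow> real ^ 'n"
  assumes "\<And>i. ((\<lambda>x. f x $ i) has_derivative (\<lambda>h. f' h $ i)) (at a within S)"
  shows "(f has_derivative f') (at a within S)"
  unfolding has_derivative_componentwise_within [of f]
  using assms by (auto simp: Basis_vec_def inner_axis)

lemma continuous_on_vec_componentwise:
  fixes f :: "'x::topological_space \<Rightarrow> real ^ 'n"
  assumes "\<And>i. continuous_on S (\<lambda>x. f x $ i)"
  shows "continuous_on S f"
  using continuous_on_vec_lambda [of S "\<lambda>i x. f x $ i"] assms by simp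

section \<open>Continuous differentiability of the feature map\<close>

text \<open>The Jacobian of \<open>feature_map\<close> at \<open>z\<close> applied to the direction
  \<open>h\<close>, written in the same block order so that the blocks can be compared coordinate by
  coordinate.\<close>

definition feature_deriv :: "real ^ 'd \<Rightarrow> real ^ 'd \<Rightarrow> real ^ ('d feature)"
  where "feature_deriv z h =
    (\<chi> _. 0) @\<^sub>v h @\<^sub>v (\<chi> i. (1 - (tanh (z $ i))\<^sup>2) * h $ i) @\<^sub>v (\<chi> i. 2 * z $ i * h $ i)
      @\<^sub>v (\<chi> i. 3 * (z $ i)\<^sup>2 * h $ i) @\<^sub>v (\<chi> _. 2 * (z \<bullet> h))"

lemma feature_cases:
  fixes i :: "'d feature"
  obtains u where "i = Inl u" | j where "i = Inr (Inl j)" | j where "i = Inr (Inr (Inl j))"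
  | j where "i = Inr (Inr (Inr (Inl j)))" | j where "i = Inr (Inr (Inr (Inr (Inl j))))"
  | u where "i = Inr (Inr (Inr (Inr (Inr u))))"
  by (metis sum.exhaust)

lemma has_derivative_feature_map:
  "(feature_map has_derivative feature_deriv z) (at z)"
proof (rule has_derivative_vec_componentwise)
  have nth: "((\<lambda>x::real^'a. x $ j) has_derivative (\<lambda>h. h $ j)) (at z)" for j
    by (rule bounded_linear.has_derivative [OF bounded_linear_vec_nth has_derivative_ident])
  \<comment> \<open>The \<open>tanh\<close>, square and cube blocks act on one coordinate each, so
    they reduce to one-variable derivatives.\<close>
  have chain: "((\<lambda>x::real^'a. g (x $ j)) has_derivative (\<lambda>h. d * h $ j)) (at z)"
    if "(g has_real_derivative d) (at (z $ j))" for g d j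
    using has_derivative_compose [OF nth that [unfolded has_field_derivative_def]] .
  fix i :: "'a feature"
  show "((\<lambda>z. feature_map z $ i) has_derivative (\<lambda>h. feature_deriv z h $ i)) (at z)"
  proof (cases i rule: feature_cases)
    case (3 j)
    then show ?thesis
      by (auto simp: feature_map_def feature_deriv_def intro!: chain derivative_eq_intros)
  next
    case (4 j)
    then show ?thesis
      by (auto simp: feature_map_def feature_deriv_def intro!: chain derivative_eq_intros)
  next
    case (5 j)
    then show ?thesis
      by (auto simp: feature_map_def feature_deriv_def intro!: chain derivative_eq_intros)
  next
    \<comment> \<open>The squared norm is \<open>z \<bullet> z\<close>; the product rule and
      symmetry of the inner product give \<open>2 * (z \<bullet> h)\<close>.\<close>
    case (6 u)
    then show ?thesis
      by (auto simp: feature_map_def feature_deriv_def power2_norm_eq_inner inner_commute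
          intro!: derivative_eq_intros)
  qed (auto simp: feature_map_def feature_deriv_def intro: nth)
qed

lemma continuous_on_feature_deriv: "continuous_on S (\<lambda>z. feature_deriv z h)"
proof (rule continuous_on_vec_componentwise)
  fix i :: "'a feature"
  \<comment> \<open>Continuity of \<open>tanh\<close> is inherited from a quotient, which asks for a
    nonvanishing \<open>cosh\<close>.\<close>
  show "continuous_on S (\<lambda>z. feature_deriv z h $ i)"
    by (cases i rule: feature_cases)
      (auto simp: feature_deriv_def cosh_real_nonzero intro!: continuous_intros)
qed

text \<open>Bundling the derivative as a bounded linear function makes its continuity a statement
  about the operator norm.\<close>

lemma feature_map_C1:
  "\<exists>D :: real ^ 'd \<Rightarrow> (real ^ 'd) \<Rightarrow>\<^sub>L (real ^ ('d feature)).
    (\<forall>z. (feature_map has_derivative blinfun_apply (D z)) (at z)) \<and> continuous_on UNIV D"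
proof (intro exI conjI allI)
  \<comment> \<open>\<open>Blinfun\<close> is inverted by \<open>blinfun_apply\<close> only on
    bounded linear maps; boundedness holds because the map is a derivative.\<close>
  have apply_eq: "blinfun_apply (Blinfun (feature_deriv z)) = feature_deriv z" for z :: "real ^ 'd"
    by (rule bounded_linear_Blinfun_apply
        [OF has_derivative_bounded_linear [OF has_derivative_feature_map]])
  show "(feature_map has_derivative blinfun_apply (Blinfun (feature_deriv z))) (at z)"
    for z :: "real ^ 'd"
    unfolding apply_eq by (rule has_derivative_feature_map)
  \<comment> \<open>In finite dimension, operator-norm continuity can be tested on basis directions
    \<open>h\<close>.\<close>
  show "continuous_on UNIV (\<lambda>z :: real ^ 'd. Blinfun (feature_deriv z))"
    by (rule continuous_on_blinfun_componentwise) (simp add: apply_eq continuous_on_feature_deriv)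
qed

section \<open>Lipschitz estimates for one step\<close>

lemma feature_map_lipschitz_on_cball:
  obtains B where "0 \<le> B"
    and "\<And>x y. x \<in> cball 0 R \<Longrightarrow> y \<in> cball 0 R \<Longrightarrow>
      norm (feature_map x - feature_map y) \<le> B * norm (x - y)"
proof -
  obtain D :: "real ^ 'a \<Rightarrow> (real ^ 'a) \<Rightarrow>\<^sub>L (real ^ ('a feature))"
    where D: "\<And>z. (feature_map has_derivative blinfun_apply (D z)) (at z)"
      and cont: "continuous_on UNIV D"
    using feature_map_C1 by blast
  have "compact (D ` cball 0 R)"
    by (rule compact_continuous_image [OF continuous_on_subset [OF cont]]) auto
  then obtain B where "0 < B" and B: "\<And>z. z \<in> cball 0 R \<Longrightarrow> norm (D z) \<le> B"
    by (metis bounded_pos compact_imp_bounded imageI)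
  show thesis
  proof
    show "0 \<le> B" using \<open>0 < B\<close> by simp
    \<comment> \<open>The mean value inequality asks for a bound on \<open>onorm\<close>, which is
      the norm of \<open>D z\<close> as a bounded linear function.\<close>
    show "norm (feature_map x - feature_map y) \<le> B * norm (x - y)"
      if "x \<in> cball 0 R" "y \<in> cball 0 R" for x y :: "real ^ 'a"
      by (rule differentiable_bound [OF convex_cball _ _ that])
        (use B in \<open>auto intro: has_derivative_at_withinI [OF D] simp: norm_blinfun.rep_eq [symmetric]\<close>)
  qed
qed

text \<open>The two blocks are orthogonal, so Pythagoras applies; the missing cross term of the
  square is nonnegative.\<close>

lemma norm_vconcat_le: "norm (s @\<^sub>v w) \<le> norm s + norm w"
proof (rule power2_le_imp_le)
  \<comment> \<open>The sum over the sum type splits once \<open>UNIV\<close> is written as a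
    disjoint sum; the simp rule that would fold it back is disabled.\<close>
  have "(norm (s @\<^sub>v w))\<^sup>2 = (norm s)\<^sup>2 + (norm w)\<^sup>2"
    by (simp add: power2_norm_eq_inner inner_vec_def UNIV_Plus_UNIV [symmetric] sum.Plus
        del: UNIV_Plus_UNIV)
  also have "\<dots> \<le> (norm s + norm w)\<^sup>2"
    by (simp add: power2_sum)
  finally show "(norm (s @\<^sub>v w))\<^sup>2 \<le> (norm s + norm w)\<^sup>2" .
qed simp

lemma vconcat_diff: "(s @\<^sub>v w) - (s' @\<^sub>v w') = (s - s') @\<^sub>v (w - w')"
  by (simp add: vec_eq_iff vconcat_def split: sum.split)

lemma nlarx_step_lipschitz_on_compact:
  fixes K :: "((real ^ 'a::{finite,linorder}) \<times> (real ^ 'w)) set"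
  assumes "compact K"
  shows "\<exists>Ls\<ge>0. \<exists>Lw\<ge>0. step_lipschitz_on \<theta> K Ls Lw"
proof -
  obtain R where R: "\<And>p. p \<in> K \<Longrightarrow> norm p \<le> R"
    using compact_imp_bounded [OF assms] by (auto simp: bounded_iff)
  \<comment> \<open>Each half of a pair in \<open>K\<close> has norm at most \<open>R\<close>, so
    the concatenation has norm at most \<open>R + R\<close>.\<close>
  obtain B where "0 \<le> B" and B: "\<And>x y :: real ^ ('a + 'w). x \<in> cball 0 (R + R) \<Longrightarrow>
      y \<in> cball 0 (R + R) \<Longrightarrow> norm (feature_map x - feature_map y) \<le> B * norm (x - y)"
    using feature_map_lipschitz_on_cball by metis
  \<comment> \<open>The first coordinate has constant \<open>norm \<theta> * B\<close> and the
    shifted ones have constant 1; the sum of the two serves every coordinate.\<close>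
  define C where "C = norm \<theta> * B + 1"
  have "0 \<le> norm \<theta> * B"
    using \<open>0 \<le> B\<close> by simp
  then have "1 \<le> C" by (simp add: C_def)
  have "norm (nlarx_step \<theta> s w - nlarx_step \<theta> s' w')
      \<le> real CARD('a) * C * norm (s - s') + real CARD('a) * C * norm (w - w')"
    if "(s, w) \<in> K" "(s', w') \<in> K" for s s' w w'
  proof -
    have in_ball: "s @\<^sub>v w \<in> cball 0 (R + R)" if "(s, w) \<in> K" for s w
      using norm_vconcat_le [of s w] R [OF that] norm_fst_le [of s w] norm_snd_le [of w s] by simp
    have comp: "\<bar>(nlarx_step \<theta> s w - nlarx_step \<theta> s' w') $ i\<bar> \<le> C * (norm (s - s') + norm (w - w'))"
      for i
    proof (cases "i = Min UNIV")
      case True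
      have "\<bar>\<theta> \<bullet> (feature_map (s @\<^sub>v w) - feature_map (s' @\<^sub>v w'))\<bar>
          \<le> norm \<theta> * norm (feature_map (s @\<^sub>v w) - feature_map (s' @\<^sub>v w'))"
        by (rule Cauchy_Schwarz_ineq2)
      also have "\<dots> \<le> norm \<theta> * (B * norm ((s @\<^sub>v w) - (s' @\<^sub>v w')))"
        by (intro mult_left_mono B in_ball that) simp
      also have "\<dots> \<le> norm \<theta> * (B * (norm (s - s') + norm (w - w')))"
        unfolding vconcat_diff by (intro mult_left_mono norm_vconcat_le \<open>0 \<le> B\<close>) simp
      also have "\<dots> \<le> C * (norm (s - s') + norm (w - w'))"
        by (simp add: C_def algebra_simps)
      finally show ?thesis
        using True by (simp add: nlarx_step_def inner_diff_right)
    next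
      case False
      then have "\<bar>(nlarx_step \<theta> s w - nlarx_step \<theta> s' w') $ i\<bar> = \<bar>(s - s') $ Max {..<i}\<bar>"
        by (simp add: nlarx_step_def)
      also have "\<dots> \<le> norm (s - s')"
        by (rule component_le_norm_cart)
      also have "\<dots> \<le> 1 * (norm (s - s') + norm (w - w'))"
        by simp
      also have "\<dots> \<le> C * (norm (s - s') + norm (w - w'))"
        by (intro mult_right_mono \<open>1 \<le> C\<close>) simp
      finally show ?thesis .
    qed
    \<comment> \<open>Passing from coordinates to the Euclidean norm through the l1 norm costs the
      factor \<open>CARD('a)\<close>.\<close>
    have "norm (nlarx_step \<theta> s w - nlarx_step \<theta> s' w')
        \<le> (\<Sum>i\<in>UNIV. \<bar>(nlarx_step \<theta> s w - nlarx_step \<theta> s' w') $ i\<bar>)"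
      by (rule norm_le_l1_cart)
    also have "\<dots> \<le> (\<Sum>i\<in>(UNIV::'a set). C * (norm (s - s') + norm (w - w')))"
      by (intro sum_mono comp)
    finally show ?thesis
      by (simp add: algebra_simps)
  qed
  then have "step_lipschitz_on \<theta> K (real CARD('a) * C) (real CARD('a) * C)"
    by (auto simp: step_lipschitz_on_def)
  moreover have "0 \<le> real CARD('a) * C"
    using \<open>1 \<le> C\<close> by simp
  ultimately show ?thesis by blast
qed

section \<open>Error propagation along the composed forecast\<close>

text \<open>The set \<open>P\<close> is left free so that the estimate applies both to the two
  visited trajectories alone and to all of \<open>K\<close>.\<close>

lemma composed_stability:
  assumes lip: "step_lipschitz_on \<theta> P Ls Lw" and "0 \<le> Ls"
    and P: "visited_pairs \<theta> N s0 w \<subseteq> P" "visited_pairs \<theta> N s0' w' \<subseteq> P"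
  shows "h \<le> N \<Longrightarrow> norm (composed \<theta> w h s0 - composed \<theta> w' h s0')
    \<le> Ls ^ h * norm (s0 - s0') + Lw * (\<Sum>j=1..h. Ls ^ (h - j) * norm (w j - w' j))"
proof (induction h)
  case 0
  then show ?case by simp
next
  case (Suc h)
  \<comment> \<open>Step \<open>Suc h\<close> starts from state \<open>h\<close> and uses driver
    \<open>Suc h\<close>; since \<open>Suc h \<le> N\<close>, this pair is among the visited
    ones.\<close>
  have "(composed \<theta> w h s0, w (Suc h)) \<in> P" "(composed \<theta> w' h s0', w' (Suc h)) \<in> P"
    using P Suc.prems unfolding visited_pairs_def by (auto simp: Suc_le_eq)
  then have "norm (composed \<theta> w (Suc h) s0 - composed \<theta> w' (Suc h) s0')
      \<le> Ls * norm (composed \<theta> w h s0 - composed \<theta> w' h s0') + Lw * norm (w (Suc h) - w' (Suc h))"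
    using lip unfolding step_lipschitz_on_def by fastforce
  also have "\<dots> \<le> Ls * (Ls ^ h * norm (s0 - s0')
        + Lw * (\<Sum>j=1..h. Ls ^ (h - j) * norm (w j - w' j))) + Lw * norm (w (Suc h) - w' (Suc h))"
    using Suc \<open>0 \<le> Ls\<close> by (intro add_right_mono mult_left_mono) auto
  also have "\<dots> = Ls ^ Suc h * norm (s0 - s0')
      + Lw * ((\<Sum>j=1..h. Ls * (Ls ^ (h - j) * norm (w j - w' j))) + norm (w (Suc h) - w' (Suc h)))"
    by (simp add: algebra_simps sum_distrib_left)
  \<comment> \<open>For \<open>j \<le> h\<close> the factor \<open>Ls\<close> raises the exponent to
    \<open>Suc h - j\<close>. The newest driver difference becomes the summand
    \<open>j = Suc h\<close>, with weight \<open>Ls ^ 0 = 1\<close>.\<close>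
  also have "(\<Sum>j=1..h. Ls * (Ls ^ (h - j) * norm (w j - w' j)))
      = (\<Sum>j=1..h. Ls ^ (Suc h - j) * norm (w j - w' j))"
    by (intro sum.cong) (auto simp: Suc_diff_le)
  finally show ?case by simp
qed

text \<open>The offset \<open>\<mu>\<close> cancels, and a single coordinate is bounded by the
  norm.\<close>

lemma forecast_diff_le:
  assumes "0 \<le> \<sigma>"
  shows "\<bar>forecast \<mu> \<sigma> NQ \<theta> s0 w (NQ + h) - forecast \<mu> \<sigma> NQ \<theta> s0' w' (NQ + h)\<bar>
    \<le> \<sigma> * norm (composed \<theta> w h s0 - composed \<theta> w' h s0')"
proof -
  have "\<bar>forecast \<mu> \<sigma> NQ \<theta> s0 w (NQ + h) - forecast \<mu> \<sigma> NQ \<theta> s0' w' (NQ + h)\<bar>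
      = \<sigma> * \<bar>(composed \<theta> w h s0 - composed \<theta> w' h s0') $ Min UNIV\<bar>"
    using assms by (simp add: forecast_def abs_mult flip: right_diff_distrib)
  also have "\<dots> \<le> \<sigma> * norm (composed \<theta> w h s0 - composed \<theta> w' h s0')"
    by (intro mult_left_mono component_le_norm_cart assms)
  finally show ?thesis .
qed

section \<open>Existence and uniqueness of the forecast\<close>

text \<open>The recursion is deterministic. Characterizing its solutions by an equation yields
  existence and uniqueness at once.\<close>

lemma is_forecast_iff:
  "is_forecast \<mu> \<sigma> NQ N \<theta> s0 w q \<longleftrightarrow> q = restrict (forecast \<mu> \<sigma> NQ \<theta> s0 w) {NQ + 1..NQ + N}"
proof
  assume "is_forecast \<mu> \<sigma> NQ N \<theta> s0 w q"
  then obtain s where ext: "q \<in> extensional {NQ + 1..NQ + N}" and "s 0 = s0"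
    and step: "\<And>h. h < N \<Longrightarrow> s (Suc h) = nlarx_step \<theta> (s h) (w (Suc h))"
    and q: "\<And>h. h \<in> {1..N} \<Longrightarrow> q (NQ + h) = \<mu> + \<sigma> * (s h $ Min UNIV)"
    unfolding is_forecast_def by blast
  \<comment> \<open>The recursion determines \<open>s\<close> only up to index \<open>N\<close>,
    which covers every forecast time.\<close>
  have s: "s h = composed \<theta> w h s0" if "h \<le> N" for h
    using that by (induction h) (simp_all add: \<open>s 0 = s0\<close> step)
  show "q = restrict (forecast \<mu> \<sigma> NQ \<theta> s0 w) {NQ + 1..NQ + N}"
  \<comment> \<open>Both functions are \<open>undefined\<close> outside the horizon, so only times
    inside it are compared.\<close>
  proof (rule extensionalityI [OF ext restrict_extensional])
    fix t assume t: "t \<in> {NQ + 1..NQ + N}"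
    then have "q (NQ + (t - NQ)) = \<mu> + \<sigma> * (s (t - NQ) $ Min UNIV)"
      by (intro q) auto
    with t show "q t = restrict (forecast \<mu> \<sigma> NQ \<theta> s0 w) {NQ + 1..NQ + N} t"
      using s [of "t - NQ"] by (auto simp: forecast_def)
  qed
next
  assume "q = restrict (forecast \<mu> \<sigma> NQ \<theta> s0 w) {NQ + 1..NQ + N}"
  then show "is_forecast \<mu> \<sigma> NQ N \<theta> s0 w q"
    unfolding is_forecast_def
    by (auto simp: forecast_def intro!: exI [of _ "\<lambda>h. composed \<theta> w h s0"])
qed

section \<open>A single Lipschitz constant on the whole horizon\<close>

text \<open>\<open>max 1 Ls ^ N\<close> dominates every power \<open>Ls ^ k\<close> with
  \<open>k \<le> N\<close>, whether \<open>Ls\<close> lies below or above 1.\<close>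

lemma geometric_bound_uniform:
  fixes Ls Lw :: real and d :: "nat \<Rightarrow> real"
  assumes "0 \<le> Ls" "0 \<le> Lw" "0 \<le> x" "\<And>j. 0 \<le> d j" "h \<le> N"
  shows "Ls ^ h * x + Lw * (\<Sum>j=1..h. Ls ^ (h - j) * d j)
    \<le> (1 + Lw) * max 1 Ls ^ N * (x + (\<Sum>j=1..h. d j))"
proof -
  define A where "A = max 1 Ls ^ N"
  have A: "Ls ^ k \<le> A" if "k \<le> N" for k
  proof -
    have "Ls ^ k \<le> max 1 Ls ^ k"
      using assms by (intro power_mono) auto
    also have "\<dots> \<le> A"
      unfolding A_def using that by (intro power_increasing) auto
    finally show ?thesis .
  qed
  have "0 \<le> A" by (simp add: A_def)
  have "(\<Sum>j=1..h. Ls ^ (h - j) * d j) \<le> A * (\<Sum>j=1..h. d j)"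
    unfolding sum_distrib_left using assms by (intro sum_mono mult_right_mono A) auto
  then have "Ls ^ h * x + Lw * (\<Sum>j=1..h. Ls ^ (h - j) * d j) \<le> A * x + Lw * (A * (\<Sum>j=1..h. d j))"
    using assms by (intro add_mono mult_right_mono mult_left_mono A) auto
  \<comment> \<open>The added cross terms are nonnegative and complete the expression to a
    product.\<close>
  also have "\<dots> \<le> A * x + Lw * (A * (\<Sum>j=1..h. d j)) + (Lw * (A * x) + A * (\<Sum>j=1..h. d j))"
    using assms \<open>0 \<le> A\<close> by (simp add: sum_nonneg)
  also have "\<dots> = (1 + Lw) * A * (x + (\<Sum>j=1..h. d j))"
    by (simp add: algebra_simps)
  finally show ?thesis by (simp add: A_def)
qed

text \<open>The constant is chosen before the initial states and drivers, hence is uniform over all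
  forecasts that stay in \<open>K\<close>.\<close>

lemma forecast_lipschitz_on_horizon:
  fixes K :: "((real ^ 'a::{finite,linorder}) \<times> (real ^ 'w)) set"
  assumes "compact K" and "0 \<le> \<sigma>"
  shows "\<exists>L\<ge>0. \<forall>s0 s0' w w'.
    visited_pairs \<theta> N s0 w \<subseteq> K \<longrightarrow> visited_pairs \<theta> N s0' w' \<subseteq> K \<longrightarrow>
    (\<forall>h\<in>{1..N}.
      norm (composed \<theta> w h s0 - composed \<theta> w' h s0')
        \<le> L * (norm (s0 - s0') + (\<Sum>j=1..h. norm (w j - w' j)))
      \<and> \<bar>forecast \<mu> \<sigma> NQ \<theta> s0 w (NQ + h) - forecast \<mu> \<sigma> NQ \<theta> s0' w' (NQ + h)\<bar>
        \<le> L * (norm (s0 - s0') + (\<Sum>j=1..h. norm (w j - w' j))))"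
proof -
  obtain Ls Lw where "0 \<le> Ls" "0 \<le> Lw" and lip: "step_lipschitz_on \<theta> K Ls Lw"
    using nlarx_step_lipschitz_on_compact [OF \<open>compact K\<close>] by blast
  define M where "M = (1 + Lw) * max 1 Ls ^ N"
  have "0 \<le> M" using \<open>0 \<le> Lw\<close> by (simp add: M_def)
  show ?thesis
  \<comment> \<open>The factor \<open>1 + \<sigma>\<close> dominates both 1, for the states, and
    \<open>\<sigma>\<close>, for the physical forecast.\<close>
  proof (intro exI [of _ "(1 + \<sigma>) * M"] conjI allI impI ballI)
    show "0 \<le> (1 + \<sigma>) * M" using \<open>0 \<le> M\<close> \<open>0 \<le> \<sigma>\<close> by simp
    fix s0 s0' w w' h
    assume K: "visited_pairs \<theta> N s0 w \<subseteq> K" "visited_pairs \<theta> N s0' w' \<subseteq> K" and "h \<in> {1..N}"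
    then have "h \<le> N" by simp
    define E where "E = norm (s0 - s0') + (\<Sum>j=1..h. norm (w j - w' j))"
    have "0 \<le> M * E" using \<open>0 \<le> M\<close> by (simp add: E_def sum_nonneg)
    have state: "norm (composed \<theta> w h s0 - composed \<theta> w' h s0') \<le> M * E"
      unfolding M_def E_def
      by (rule order_trans [OF composed_stability [OF lip \<open>0 \<le> Ls\<close> K \<open>h \<le> N\<close>]
            geometric_bound_uniform])
        (simp_all add: \<open>0 \<le> Ls\<close> \<open>0 \<le> Lw\<close> \<open>h \<le> N\<close>)
    then show "norm (composed \<theta> w h s0 - composed \<theta> w' h s0')
        \<le> (1 + \<sigma>) * M * (norm (s0 - s0') + (\<Sum>j=1..h. norm (w j - w' j)))"
      unfolding E_def [symmetric] using mult_nonneg_nonneg [OF \<open>0 \<le> \<sigma>\<close> \<open>0 \<le> M * E\<close>]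
      by (simp add: algebra_simps)
    have "\<bar>forecast \<mu> \<sigma> NQ \<theta> s0 w (NQ + h) - forecast \<mu> \<sigma> NQ \<theta> s0' w' (NQ + h)\<bar> \<le> \<sigma> * (M * E)"
      by (rule order_trans [OF forecast_diff_le [OF \<open>0 \<le> \<sigma>\<close>] mult_left_mono [OF state \<open>0 \<le> \<sigma>\<close>]])
    then show "\<bar>forecast \<mu> \<sigma> NQ \<theta> s0 w (NQ + h) - forecast \<mu> \<sigma> NQ \<theta> s0' w' (NQ + h)\<bar>
        \<le> (1 + \<sigma>) * M * (norm (s0 - s0') + (\<Sum>j=1..h. norm (w j - w' j)))"
      unfolding E_def [symmetric] using \<open>0 \<le> M * E\<close> by (simp add: algebra_simps)
  qed
qed

text \<open>Lipschitz constants are produced on \<open>K\<close>, while the stability bounds accept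
  any constants valid on the union of the visited pairs. As that union lies in \<open>K\<close>, the
  constants produced on \<open>K\<close> qualify.\<close>

theorem theorem3:
  fixes \<theta> :: "real ^ (('a::{finite,linorder} + 'm::finite \<times> 'b::finite) feature)"
    and \<mu> \<sigma> :: real
    and NQ Nf :: nat
    and K :: "((real ^ ('a::{finite,linorder})) \<times> (real ^ ('m \<times> 'b))) set"
    and s01 s02 :: "real ^ ('a::{finite,linorder})"
    and w1 w2 :: "nat \<Rightarrow> real ^ ('m \<times> 'b)"
  assumes "\<sigma> > 0" and "NQ \<ge> 1" and "Nf \<ge> 1"
    and "compact K"
    and "visited_pairs \<theta> Nf s01 w1 \<subseteq> K"
    and "visited_pairs \<theta> Nf s02 w2 \<subseteq> K"
  shows
    "(\<exists>D :: real ^ ('a + 'm \<times> 'b) \<Rightarrow> (real ^ ('a + 'm \<times> 'b)) \<Rightarrow>\<^sub>L (real ^ (('a + 'm \<times> 'b) feature)).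
        (\<forall>z. (feature_map has_derivative blinfun_apply (D z)) (at z)) \<and> continuous_on UNIV D)
     \<and> (\<exists>Ls\<ge>0. \<exists>Lw\<ge>0. step_lipschitz_on \<theta> K Ls Lw)
     \<and> (\<forall>Ls\<ge>0. \<forall>Lw\<ge>0.
          step_lipschitz_on \<theta> (visited_pairs \<theta> Nf s01 w1 \<union> visited_pairs \<theta> Nf s02 w2) Ls Lw \<longrightarrow>
          (\<forall>h\<in>{1..Nf}.
             norm (composed \<theta> w1 h s01 - composed \<theta> w2 h s02)
               \<le> Ls ^ h * norm (s01 - s02) + Lw * (\<Sum>j=1..h. Ls ^ (h - j) * norm (w1 j - w2 j))
             \<and>
             \<bar>forecast \<mu> \<sigma> NQ \<theta> s01 w1 (NQ + h) - forecast \<mu> \<sigma> NQ \<theta> s02 w2 (NQ + h)\<bar>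
               \<le> \<sigma> * (Ls ^ h * norm (s01 - s02)
                     + Lw * (\<Sum>j=1..h. Ls ^ (h - j) * norm (w1 j - w2 j)))))
     \<and> (\<forall>(s0 :: real ^ ('a::{finite,linorder})) w.
          is_forecast \<mu> \<sigma> NQ Nf \<theta> s0 w (restrict (forecast \<mu> \<sigma> NQ \<theta> s0 w) {NQ + 1..NQ + Nf}) \<and>
          (\<exists>!q. is_forecast \<mu> \<sigma> NQ Nf \<theta> s0 w q))
     \<and> (\<exists>L\<ge>0. \<forall>(s0 :: real ^ ('a::{finite,linorder})) s0' w w'.
          visited_pairs \<theta> Nf s0 w \<subseteq> K \<longrightarrow> visited_pairs \<theta> Nf s0' w' \<subseteq> K \<longrightarrow>
          (\<forall>h\<in>{1..Nf}.
             norm (composed \<theta> w h s0 - composed \<theta> w' h s0')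
               \<le> L * (norm (s0 - s0') + (\<Sum>j=1..h. norm (w j - w' j)))
             \<and>
             \<bar>forecast \<mu> \<sigma> NQ \<theta> s0 w (NQ + h) - forecast \<mu> \<sigma> NQ \<theta> s0' w' (NQ + h)\<bar>
               \<le> L * (norm (s0 - s0') + (\<Sum>j=1..h. norm (w j - w' j)))))"
proof (intro conjI allI impI ballI)
  show "\<exists>D :: real ^ ('a + 'm \<times> 'b) \<Rightarrow> (real ^ ('a + 'm \<times> 'b)) \<Rightarrow>\<^sub>L (real ^ (('a + 'm \<times> 'b) feature)).
      (\<forall>z. (feature_map has_derivative blinfun_apply (D z)) (at z)) \<and> continuous_on UNIV D"
    by (rule feature_map_C1)
  show "\<exists>Ls\<ge>0. \<exists>Lw\<ge>0. step_lipschitz_on \<theta> K Ls Lw"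
    by (rule nlarx_step_lipschitz_on_compact [OF \<open>compact K\<close>])
next
  fix Ls Lw :: real and h
  assume "0 \<le> Ls"
    and lip: "step_lipschitz_on \<theta> (visited_pairs \<theta> Nf s01 w1 \<union> visited_pairs \<theta> Nf s02 w2) Ls Lw"
    and "h \<in> {1..Nf}"
  then have "h \<le> Nf" by simp
  show state: "norm (composed \<theta> w1 h s01 - composed \<theta> w2 h s02)
      \<le> Ls ^ h * norm (s01 - s02) + Lw * (\<Sum>j=1..h. Ls ^ (h - j) * norm (w1 j - w2 j))"
    by (rule composed_stability [OF lip \<open>0 \<le> Ls\<close> Un_upper1 Un_upper2 \<open>h \<le> Nf\<close>])
  have "0 \<le> \<sigma>" using \<open>\<sigma> > 0\<close> by simp
  show "\<bar>forecast \<mu> \<sigma> NQ \<theta> s01 w1 (NQ + h) - forecast \<mu> \<sigma> NQ \<theta> s02 w2 (NQ + h)\<bar>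
      \<le> \<sigma> * (Ls ^ h * norm (s01 - s02) + Lw * (\<Sum>j=1..h. Ls ^ (h - j) * norm (w1 j - w2 j)))"
    by (rule order_trans [OF forecast_diff_le [OF \<open>0 \<le> \<sigma>\<close>] mult_left_mono [OF state \<open>0 \<le> \<sigma>\<close>]])
next
  fix s0 :: "real ^ ('a::{finite,linorder})" and w :: "nat \<Rightarrow> real ^ ('m \<times> 'b)"
  show "is_forecast \<mu> \<sigma> NQ Nf \<theta> s0 w (restrict (forecast \<mu> \<sigma> NQ \<theta> s0 w) {NQ + 1..NQ + Nf})"
    and "\<exists>!q. is_forecast \<mu> \<sigma> NQ Nf \<theta> s0 w q"
    \<comment> \<open>Both claims reduce to equality with the restricted forecast.\<close>
    by (simp_all add: is_forecast_iff)
next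
  show "\<exists>L\<ge>0. \<forall>(s0 :: real ^ ('a::{finite,linorder})) s0' w w'.
      visited_pairs \<theta> Nf s0 w \<subseteq> K \<longrightarrow> visited_pairs \<theta> Nf s0' w' \<subseteq> K \<longrightarrow>
      (\<forall>h\<in>{1..Nf}.
        norm (composed \<theta> w h s0 - composed \<theta> w' h s0')
          \<le> L * (norm (s0 - s0') + (\<Sum>j=1..h. norm (w j - w' j)))
        \<and> \<bar>forecast \<mu> \<sigma> NQ \<theta> s0 w (NQ + h) - forecast \<mu> \<sigma> NQ \<theta> s0' w' (NQ + h)\<bar>
          \<le> L * (norm (s0 - s0') + (\<Sum>j=1..h. norm (w j - w' j))))"
    by (rule forecast_lipschitz_on_horizon [OF \<open>compact K\<close> less_imp_le [OF \<open>\<sigma> > 0\<close>]])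
qed

end
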